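(* Let $\eta,P,\alpha,\sigma_{\mathrm c},\sigma_{\mathrm s},\Gamma_{\mathrm{sen}},\Delta_{\mathrm t,\mathrm c},\Delta_{\mathrm t,\mathrm s},\Delta_{\mathrm r,\mathrm s},D_x>0$ and $x_{\mathrm c},x_{\mathrm s}\in[0,D_x]$. Consider $$\max_{0\le x_{\mathrm t}\le D_x}\ \frac{\eta^2P}{\sigma_{\mathrm c}^2\big((x_{\mathrm t}-x_{\mathrm c})^2+\Delta_{\mathrm t,\mathrm c}^2\big)}\quad\text{s.t.}\quad \frac{\alpha\eta^4P}{\sigma_{\mathrm s}^2\big((x_{\mathrm t}-x_{\mathrm s})^2+\Delta_{\mathrm t,\mathrm s}^2\big)\Delta_{\mathrm r,\mathrm s}^2}\ge\Gamma_{\mathrm{sen}},$$ and assume $\frac{\eta^4\alpha P}{\sigma_{\mathrm s}^2\Gamma_{\mathrm{sen}}\Delta_{\mathrm r,\mathrm s}^2}\ge\Delta_{\mathrm t,\mathrm s}^2$. Put $$x_{\mathrm t}^{\pm}=x_{\mathrm s}\pm\sqrt{\frac{\eta^4\alpha P}{\sigma_{\mathrm s}^2\Gamma_{\mathrm{sen}}\Delta_{\mathrm r,\mathrm s}^2}-\Delta_{\mathrm t,\mathrm s}^2},\qquad \mathcal F=[\max\{0,x_{\mathrm t}^-\},\min\{x_{\mathrm t}^+,D_x\}],\qquad \mathcal S=\{\max\{0,x_{\mathrm t}^-\},\min\{x_{\mathrm t}^+,D_x\}\}.$$ Then the feasible set of the problem is $\mathcal F$, and an optimal solution is $$x_{\mathrm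 t}^\star=\begin{cases}x_{\mathrm c},&\text{if }x_{\mathrm c}\in\mathcal F,\\ \arg\min_{x\in\mathcal S}|x_{\mathrm c}-x|,&\text{otherwise.}\end{cases}$$
   Context: This is the transmit-antenna placement problem for a segmented waveguide on $[0,D_x]$ under segment selection, with one communication user at $x$-coordinate $x_{\mathrm c}$ and one sensing target at $x$-coordinate $x_{\mathrm s}$, in-waveguide loss neglected and the receive antenna placed at $x_{\mathrm s}$. The objective is the communication SNR and the constraint is the sensing SNR requirement. *)

theory Defs
  imports Complex_Main
begin

definition comm_snr :: "real \<Rightarrow> real \<Rightarrow> real \<Rightarrow> real \<Rightarrow> real \<Rightarrow> real \<Rightarrow> real"
  where "comm_snr \<eta> P \<sigma>c \<Delta>tc xc xt = \<eta>^2 * P / (\<sigma>c^2 * ((xt - xc)^2 + \<Delta>tc^2))"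

text \<open>The receive antenna sits at the target's coordinate \<open>xs\<close>, so the receive-side squared
  distance in the denominator is just \<open>\<Delta>rs\<close> squared.\<close>

definition sens_snr ::
  "real \<Rightarrow> real \<Rightarrow> real \<Rightarrow> real \<Rightarrow> real \<Rightarrow> real \<Rightarrow> real \<Rightarrow> real \<Rightarrow> real"
  where "sens_snr \<eta> P \<alpha> \<sigma>s \<Delta>ts \<Delta>rs xs xt =
    \<alpha> * \<eta>^4 * P / (\<sigma>s^2 * ((xt - xs)^2 + \<Delta>ts^2) * \<Delta>rs^2)"

definition feasible_set ::
  "real \<Rightarrow> real \<Rightarrow> real \<Rightarrow> real \<Rightarrow> real \<Rightarrow> real \<Rightarrow> real \<Rightarrow> real \<Rightarrow> real \<Rightarrow> real set"
  where "feasible_set \<eta> P \<alpha> \<sigma>s \<Gamma>sen \<Delta>ts \<Delta>rs Dx xs =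
    {xt. 0 \<le> xt \<and> xt \<le> Dx \<and> sens_snr \<eta> P \<alpha> \<sigma>s \<Delta>ts \<Delta>rs xs xt \<ge> \<Gamma>sen}"

end

theory Submission
  imports Defs
begin

text \<open>Both SNRs depend on \<open>xt\<close> only through one distance and decrease as it
  grows. Hence the sensing requirement bounds the distance to \<open>xs\<close>: clearing positive
  denominators gives a closed interval around \<open>xs\<close> (\<open>sens_snr_ge_iff\<close>),
  which is then cut by [0, \<open>Dx\<close>]. Maximising the communication SNR over the resulting
  interval means minimising the distance to \<open>xc\<close> (\<open>comm_snr_antimono\<close>), so
  the optimum is the projection of \<open>xc\<close> onto it: \<open>xc\<close> itself or the nearer
  endpoint (\<open>nearest_point_interval\<close>).\<close>

lemma comm_snr_antimono:
  assumes "P > 0" "\<sigma>c > 0" "\<Delta>tc > 0" and le: "\<bar>xc - x\<bar> \<le> \<bar>xc - y\<bar>"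
  shows "comm_snr \<eta> P \<sigma>c \<Delta>tc xc y \<le> comm_snr \<eta> P \<sigma>c \<Delta>tc xc x"
proof -
  have "(x - xc)^2 \<le> (y - xc)^2"
    using le by (simp add: abs_le_square_iff power2_commute)
  moreover have "0 < (x - xc)^2 + \<Delta>tc^2"
    using assms by (simp add: add_nonneg_pos)
  ultimately show ?thesis
    unfolding comm_snr_def using assms
    by (intro divide_left_mono mult_left_mono mult_pos_pos) auto
qed

lemma sens_snr_ge_iff:
  assumes "\<sigma>s > 0" "\<Gamma>sen > 0" "\<Delta>ts > 0" "\<Delta>rs > 0"
  shows "sens_snr \<eta> P \<alpha> \<sigma>s \<Delta>ts \<Delta>rs xs xt \<ge> \<Gamma>sen \<longleftrightarrow>
    \<bar>xt - xs\<bar> \<le> sqrt (\<eta>^4 * \<alpha> * P / (\<sigma>s^2 * \<Gamma>sen * \<Delta>rs^2) - \<Delta>ts^2)"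
proof -
  have pos: "0 < (xt - xs)^2 + \<Delta>ts^2"
    using assms by (simp add: add_nonneg_pos)
  have "sens_snr \<eta> P \<alpha> \<sigma>s \<Delta>ts \<Delta>rs xs xt \<ge> \<Gamma>sen \<longleftrightarrow>
      \<Gamma>sen * (\<sigma>s^2 * ((xt - xs)^2 + \<Delta>ts^2) * \<Delta>rs^2) \<le> \<alpha> * \<eta>^4 * P"
    unfolding sens_snr_def using assms pos by (intro pos_le_divide_eq mult_pos_pos) auto
  also have "\<dots> \<longleftrightarrow> ((xt - xs)^2 + \<Delta>ts^2) * (\<sigma>s^2 * \<Gamma>sen * \<Delta>rs^2) \<le> \<eta>^4 * \<alpha> * P"
    by (simp add: mult_ac)
  also have "\<dots> \<longleftrightarrow> (xt - xs)^2 + \<Delta>ts^2 \<le> \<eta>^4 * \<alpha> * P / (\<sigma>s^2 * \<Gamma>sen * \<Delta>rs^2)"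
    using assms by (intro pos_le_divide_eq[symmetric] mult_pos_pos) auto
  also have "\<dots> \<longleftrightarrow>
      (xt - xs)^2 \<le> \<eta>^4 * \<alpha> * P / (\<sigma>s^2 * \<Gamma>sen * \<Delta>rs^2) - \<Delta>ts^2"
    by (simp only: le_diff_eq)
  also have "\<dots> \<longleftrightarrow>
      \<bar>xt - xs\<bar> \<le> sqrt (\<eta>^4 * \<alpha> * P / (\<sigma>s^2 * \<Gamma>sen * \<Delta>rs^2) - \<Delta>ts^2)"
    \<comment> \<open>\<open>sqrt\<close> is odd and strictly increasing on all reals, so taking
      roots is an equivalence whatever the sign of the radicand; if it is negative, both sides are
      false.\<close>
    by (metis real_sqrt_abs real_sqrt_le_iff)
  finally show ?thesis .
qed

text \<open>When \<open>c\<close> lies outside the interval, the distance to \<open>c\<close> is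
  monotone on it, so its minimum sits at an endpoint.\<close>

lemma nearest_point_interval:
  fixes a b c :: real
  assumes "a \<le> b"
  defines "z \<equiv> (if c \<in> {a..b} then c else arg_min_on (\<lambda>x. \<bar>c - x\<bar>) {a, b})"
  shows "z \<in> {a..b}" and "y \<in> {a..b} \<Longrightarrow> \<bar>c - z\<bar> \<le> \<bar>c - y\<bar>"
proof -
  let ?m = "arg_min_on (\<lambda>x. \<bar>c - x\<bar>) {a, b}"
  have mem: "?m \<in> {a, b}"
    by (rule arg_min_if_finite(1)) auto
  then show "z \<in> {a..b}"
    using \<open>a \<le> b\<close> by (auto simp: z_def)
  \<comment> \<open>Both bounds are kept because the nearer endpoint depends on the side:
    \<open>a\<close> if \<open>c < a\<close>, \<open>b\<close> if \<open>c > b\<close>.\<close>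
  have "\<bar>c - ?m\<bar> \<le> \<bar>c - a\<bar>" "\<bar>c - ?m\<bar> \<le> \<bar>c - b\<bar>"
    by (rule arg_min_least; simp)+
  then show "\<bar>c - z\<bar> \<le> \<bar>c - y\<bar>" if "y \<in> {a..b}"
    using that by (auto simp: z_def)
qed

theorem mainTheorem5:
  fixes \<eta> P \<alpha> \<sigma>c \<sigma>s \<Gamma>sen \<Delta>tc \<Delta>ts \<Delta>rs Dx xc xs :: real
  assumes "\<eta> > 0" "P > 0" "\<alpha> > 0" "\<sigma>c > 0" "\<sigma>s > 0" "\<Gamma>sen > 0"
    and "\<Delta>tc > 0" "\<Delta>ts > 0" "\<Delta>rs > 0" "Dx > 0"
    and "xc \<in> {0..Dx}" "xs \<in> {0..Dx}"
    and "\<eta>^4 * \<alpha> * P / (\<sigma>s^2 * \<Gamma>sen * \<Delta>rs^2) \<ge> \<Delta>ts^2"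
  shows "let xm = xs - sqrt (\<eta>^4 * \<alpha> * P / (\<sigma>s^2 * \<Gamma>sen * \<Delta>rs^2) - \<Delta>ts^2);
             xp = xs + sqrt (\<eta>^4 * \<alpha> * P / (\<sigma>s^2 * \<Gamma>sen * \<Delta>rs^2) - \<Delta>ts^2);
             F = {max 0 xm..min xp Dx};
             S = {max 0 xm, min xp Dx};
             xstar = (if xc \<in> F then xc else arg_min_on (\<lambda>x. \<bar>xc - x\<bar>) S)
         in feasible_set \<eta> P \<alpha> \<sigma>s \<Gamma>sen \<Delta>ts \<Delta>rs Dx xs = F \<and>
            is_arg_max (comm_snr \<eta> P \<sigma>c \<Delta>tc xc)
              (\<lambda>x. x \<in> feasible_set \<eta> P \<alpha> \<sigma>s \<Gamma>sen \<Delta>ts \<Delta>rs Dx xs) xstar"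
proof -
  define r where "r = sqrt (\<eta>^4 * \<alpha> * P / (\<sigma>s^2 * \<Gamma>sen * \<Delta>rs^2) - \<Delta>ts^2)"
  define a where "a = max 0 (xs - r)"
  define b where "b = min (xs + r) Dx"
  define z where "z = (if xc \<in> {a..b} then xc else arg_min_on (\<lambda>x. \<bar>xc - x\<bar>) {a, b})"
  have "0 \<le> r"
    using assms by (simp add: r_def)
  \<comment> \<open>The target coordinate \<open>xs\<close> lies in [0, \<open>Dx\<close>] and, as
    \<open>r\<close> is nonnegative, in [\<open>xs - r\<close>, \<open>xs + r\<close>]; so the two
    intervals meet.\<close>
  then have "a \<le> b"
    using assms by (auto simp: a_def b_def)
  have feasible: "feasible_set \<eta> P \<alpha> \<sigma>s \<Gamma>sen \<Delta>ts \<Delta>rs Dx xs = {a..b}"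
    using assms
    by (auto simp: feasible_set_def sens_snr_ge_iff a_def b_def abs_le_iff simp flip: r_def)
  \<comment> \<open>The nearest point to \<open>xc\<close> has the largest communication SNR, by
    antitonicity in the distance.\<close>
  have "is_arg_max (comm_snr \<eta> P \<sigma>c \<Delta>tc xc) (\<lambda>x. x \<in> {a..b}) z"
    unfolding is_arg_max_linorder z_def
    using nearest_point_interval[OF \<open>a \<le> b\<close>] comm_snr_antimono assms by blast
  then show ?thesis
    unfolding Let_def r_def[symmetric] a_def[symmetric] b_def[symmetric] feasible
    by (simp add: z_def)
qed

end
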